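(* Let $n,r$ be natural numbers with $r\le n$, let $C_{n,r}=\{\eta\in\{0,1\}^n:\sum_i\eta_i=r\}$ and let $\mu_{n,r}$ be the uniform probability measure on $C_{n,r}$. For any non-empty $A\subseteq C_{n,r}$ $$\mu_{n,r}(A)\;\mathbb E_{\mu_{n,r}}\exp\Big(\frac{d_T(\cdot,A)^2}{544}\Big)\le1 .$$
   Context: For $\omega=(\omega_1,\dots,\omega_n)\in\Omega^n$ and $A\subset\Omega^n$ (here $\Omega=\{0,1\}$), Talagrand's convex distance is $$d_T(\omega,A)=\sup_{\alpha\in\mathbb R^n:\,|\alpha|_2=1}d_\alpha(\omega,A),\qquad d_\alpha(\omega,A)=\inf_{\omega'\in A}\sum_{i=1}^n|\alpha_i|\,\mathbf 1_{\omega_i\ne\omega_i'} ,$$ where $|\cdot|_2$ is the Euclidean norm. *)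

theory Defs
  imports "HOL-Probability.Probability"
begin

text \<open>
  Points of \<open>{0,1}\<^sup>n\<close> are functions on the index set \<open>{1..n}\<close>, extended by \<open>undefined\<close>
  outside of it (as is usual for \<open>\<rightarrow>\<^sub>E\<close>), so that the cube is a finite set with \<open>2\<^sup>n\<close> elements.
\<close>

definition cube :: "nat \<Rightarrow> (nat \<Rightarrow> nat) set" where
  "cube n = {1..n} \<rightarrow>\<^sub>E {0, 1}"

definition slice :: "nat \<Rightarrow> nat \<Rightarrow> (nat \<Rightarrow> nat) set" where
  "slice n r = {\<eta> \<in> cube n. (\<Sum>i=1..n. \<eta> i) = r}"

definition slice_measure :: "nat \<Rightarrow> nat \<Rightarrow> (nat \<Rightarrow> nat) measure" where
  "slice_measure n r = uniform_count_measure (slice n r)"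

definition weighted_dist ::
  "nat \<Rightarrow> (nat \<Rightarrow> real) \<Rightarrow> (nat \<Rightarrow> nat) \<Rightarrow> (nat \<Rightarrow> nat) set \<Rightarrow> real" where
  "weighted_dist n \<alpha> \<omega> A = (INF \<omega>'\<in>A. \<Sum>i=1..n. \<bar>\<alpha> i\<bar> * of_bool (\<omega> i \<noteq> \<omega>' i))"

text \<open>
  A vector \<open>\<alpha> \<in> \<real>\<^sup>n\<close> is a function of which only the values on \<open>{1..n}\<close> matter.
  For \<open>n = 0\<close> there is no unit vector; the supremum of the empty set of nonnegative reals is
  then taken to be \<open>0\<close>, since \<open>Sup {}\<close> is unspecified on \<^typ>\<open>real\<close>. For \<open>n > 0\<close> and
  \<open>A \<noteq> {}\<close> the supremum is over a nonempty set bounded above by \<open>sqrt n\<close>.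
\<close>

definition convex_dist :: "nat \<Rightarrow> (nat \<Rightarrow> nat) \<Rightarrow> (nat \<Rightarrow> nat) set \<Rightarrow> real" where
  "convex_dist n \<omega> A =
    (if n = 0 then 0
     else (SUP \<alpha>\<in>{\<alpha> :: nat \<Rightarrow> real. L2_set \<alpha> {1..n} = 1}. weighted_dist n \<alpha> \<omega> A))"

end

theory Submission imports Defs begin

text \<open>
  Identify the slice with the \<open>r\<close>-subsets of \<open>{1..n}\<close>. The Bernoulli--Laplace exchange dynamics
  satisfies a modified logarithmic Sobolev inequality (Gao and Quastel): conditioning on a single
  coordinate, the entropy between the two fibres is controlled by swaps moving that coordinate,
  because \<open>(x - y)(ln x - ln y)\<close> is jointly convex and a uniformly random swap maps one fibre onto
  the other; averaging over the coordinate closes an induction on \<open>n\<close>.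

  The function \<open>g = d\<^sub>T\<^sup>2\<close> is self-bounding for this dynamics: if \<open>\<alpha>\<close> is a nearly optimal unit vector
  at \<open>S\<close>, a swap of \<open>a\<close> and \<open>b\<close> decreases \<open>d\<^sub>T\<close> by at most about \<open>\<bar>\<alpha>\<^sub>a\<bar> + \<bar>\<alpha>\<^sub>b\<bar>\<close>, so that the squared
  decrements of \<open>g\<close> sum to \<open>O(n g)\<close>, while each swap changes \<open>g\<close> by at most 2. Hence
  \<open>\<psi> t = ln (E exp (t g))\<close> satisfies \<open>t \<psi>' - \<psi> \<le> 80 t\<^sup>2 \<psi>'\<close> for small \<open>\<bar>t\<bar>\<close>, and
  integrating gives \<open>\<psi> (1/544) + \<psi> (-1/40) \<le> 0\<close>. Since \<open>g\<close> vanishes on \<open>A\<close>,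
  the probability of \<open>A\<close> is at most \<open>exp (\<psi> (-1/40))\<close>.
\<close>

section \<open>Modified logarithmic Sobolev inequality on slices\<close>

text \<open>This is \<open>card X\<close> times the entropy of \<open>f\<close> under the uniform
  measure on \<open>X\<close>. Without the normalisation, the entropies of disjoint blocks can
  simply be added.\<close>

definition ent :: "'a set \<Rightarrow> ('a \<Rightarrow> real) \<Rightarrow> real" where
  "ent X f = (\<Sum>x\<in>X. f x * ln (f x)) - sum f X * ln (sum f X / card X)"

text \<open>The integrand of the Dirichlet form of \<open>f\<close> against \<open>ln f\<close>:
  symmetric, homogeneous of degree one and jointly convex.\<close>

definition dform :: "real \<Rightarrow> real \<Rightarrow> real" where
  "dform x y = (x - y) * (ln x - ln y)"

definition ksubsets :: "'a set \<Rightarrow> nat \<Rightarrow> 'a set set" where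
  "ksubsets I r = {S. S \<subseteq> I \<and> card S = r}"

definition swap :: "'a \<Rightarrow> 'a \<Rightarrow> 'a set \<Rightarrow> 'a set" where
  "swap a b S = insert b (S - {a})"

text \<open>Swaps are directed: an exchange between two neighbouring sets is listed once from each
  of its ends. This is the source of a factor 2 later.\<close>

definition swaps :: "'a set \<Rightarrow> nat \<Rightarrow> ('a set \<times> 'a \<times> 'a) set" where
  "swaps I r = (SIGMA S:ksubsets I r. S \<times> (I - S))"

section \<open>Entropy inequalities for sums and for two blocks\<close>

text \<open>The bound \<open>ln z <= z - 1\<close>, taken at the ratio of \<open>g p / f p\<close>
  to the ratio of the totals, gives a termwise estimate whose correction terms cancel after
  summation.\<close>

lemma log_sum_inequality:
  fixes f g :: "'a \<Rightarrow> real"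
  assumes "finite P" "P \<noteq> {}" and pos: "\<And>p. p \<in> P \<Longrightarrow> f p > 0" "\<And>p. p \<in> P \<Longrightarrow> g p > 0"
  shows "sum f P * (ln (sum f P) - ln (sum g P)) \<le> (\<Sum>p\<in>P. f p * (ln (f p) - ln (g p)))"
proof -
  define a b where "a = sum f P" and "b = sum g P"
  have a: "a > 0" and b: "b > 0"
    unfolding a_def b_def using assms by (auto intro!: sum_pos)
  have "f p * (ln a - ln b) + f p - g p * (a / b) \<le> f p * (ln (f p) - ln (g p))" if "p \<in> P" for p
  proof -
    have fg: "f p > 0" "g p > 0" using pos that by auto
    have "ln (g p * a / (f p * b)) \<le> g p * a / (f p * b) - 1"
      using fg a b by (intro ln_le_minus_one) auto
    moreover have "ln (g p * a / (f p * b)) = ln (g p) + ln a - ln (f p) - ln b"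
      using fg a b by (simp add: ln_mult ln_div)
    ultimately have "f p * (ln (g p) + ln a - ln (f p) - ln b) \<le> f p * (g p * a / (f p * b) - 1)"
      using fg by (intro mult_left_mono) auto
    also have "\<dots> = g p * (a / b) - f p" using fg b by (simp add: field_simps)
    finally show ?thesis by (simp add: algebra_simps)
  qed
  then have "(\<Sum>p\<in>P. f p * (ln a - ln b) + f p - g p * (a / b))
      \<le> (\<Sum>p\<in>P. f p * (ln (f p) - ln (g p)))"
    by (rule sum_mono)
  moreover have "(\<Sum>p\<in>P. f p * (ln a - ln b) + f p - g p * (a / b)) = a * (ln a - ln b) + a - b * (a / b)"
    unfolding a_def b_def by (simp only: sum.distrib sum_subtractf sum_distrib_right)
  ultimately show ?thesis using b unfolding a_def [symmetric] b_def [symmetric] by simp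
qed

text \<open>Joint convexity and homogeneity of \<open>dform\<close> make it subadditive: it is a sum
  of two relative entropy terms, and the log-sum inequality applies to each.\<close>

lemma dform_sum:
  fixes f g :: "'a \<Rightarrow> real"
  assumes "finite P" "P \<noteq> {}" "\<And>p. p \<in> P \<Longrightarrow> f p > 0" "\<And>p. p \<in> P \<Longrightarrow> g p > 0"
  shows "dform (sum f P) (sum g P) \<le> (\<Sum>p\<in>P. dform (f p) (g p))"
proof -
  have *: "dform x y = x * (ln x - ln y) + y * (ln y - ln x)" for x y
    by (simp add: dform_def algebra_simps)
  show ?thesis
    unfolding * sum.distrib using log_sum_inequality[of P f g] log_sum_inequality[of P g f] assms
    by (intro add_mono) auto
qed

lemma dform_divide:
  "M > 0 \<Longrightarrow> x > 0 \<Longrightarrow> y > 0 \<Longrightarrow> dform (x / M) (y / M) = dform x y / M"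
  by (simp add: dform_def ln_div field_simps)

text \<open>The left side is the entropy of a function constant on two blocks of masses
  \<open>M\<close> and \<open>N\<close>. Concavity of \<open>ln\<close> replaces the logarithm of
  the overall mean by the weighted mean of logarithms; what remains is exactly the covariance on the
  right.\<close>

lemma entropy_two_blocks_le:
  fixes M N x y :: real
  assumes "M > 0" "N > 0" "x > 0" "y > 0"
  shows "x * ln (x / M) + y * ln (y / N) - (x + y) * ln ((x + y) / (M + N))
      \<le> M * N / (M + N) * dform (x / M) (y / N)"
proof -
  define a b p q where "a = x / M" and "b = y / N" and "p = M / (M + N)" and "q = N / (M + N)"
  have pq: "p + q = 1" "p > 0" "q > 0" and ab: "a > 0" "b > 0"
    unfolding p_def q_def a_def b_def using assms by (auto simp flip: add_divide_distrib)
  have xy: "x = M * a" "y = N * b" using assms by (auto simp: a_def b_def)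
  have m: "(x + y) / (M + N) = p * a + q * b"
    using assms by (simp add: p_def q_def xy add_divide_distrib)
  have conc: "p * ln a + q * ln b \<le> ln (p * a + q * b)"
  proof -
    have "concave_on {0<..} (ln :: real \<Rightarrow> real)" by (rule ln_concave)
    then have "(1 - q) * ln a + q * ln b \<le> ln ((1 - q) * a + q * b)"
      using concave_onD[of "{0<..}" ln q a b] pq ab by auto
    moreover have "1 - q = p" using pq by simp
    ultimately show ?thesis by metis
  qed
  have "(x + y) * (p * ln a + q * ln b) \<le> (x + y) * ln ((x + y) / (M + N))"
    unfolding m using conc assms by (intro mult_left_mono) auto
  moreover have "x * ln a + y * ln b - (x + y) * (p * ln a + q * ln b) = M * N / (M + N) * dform a b"
  proof -
    have "p = 1 - q" using pq by simp
    define K where "K = M * N / (M + N)"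
    have K: "M * q = K" "N * p = K" by (auto simp: p_def q_def K_def)
    have "x * ln a + y * ln b - (x + y) * (p * ln a + q * ln b) = (x * q - y * p) * (ln a - ln b)"
      unfolding \<open>p = 1 - q\<close> by (simp add: algebra_simps)
    also have "x * q - y * p = a * (M * q) - b * (N * p)" by (simp add: xy)
    finally show ?thesis unfolding K K_def[symmetric] by (simp add: dform_def algebra_simps)
  qed
  ultimately show ?thesis unfolding a_def[symmetric] b_def[symmetric] by linarith
qed

text \<open>Chain rule for entropy: the part within the blocks is kept, and the part between them is
  estimated by \<open>entropy_two_blocks_le\<close>.\<close>

lemma ent_Un_disjoint_le:
  assumes "finite X" "finite Y" "X \<inter> Y = {}" "X \<noteq> {}" "Y \<noteq> {}"
    and pos: "\<And>x. x \<in> X \<union> Y \<Longrightarrow> f x > 0"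
  shows "ent (X \<union> Y) f \<le> ent X f + ent Y f
    + real (card X) * card Y / (real (card X) + card Y)
      * dform (sum f X / card X) (sum f Y / card Y)"
proof -
  have c: "real (card X) > 0" "real (card Y) > 0" using assms by (auto simp: card_gt_0_iff)
  have s: "sum f X > 0" "sum f Y > 0" using assms by (auto intro!: sum_pos)
  show ?thesis
    using entropy_two_blocks_le[OF c s] assms
    by (simp add: ent_def sum.union_disjoint card_Un_disjoint algebra_simps)
qed

lemma ent_singleton [simp]: "ent {x} f = 0"
  by (simp add: ent_def)

lemma ent_empty [simp]: "ent {} f = 0"
  by (simp add: ent_def)

lemma ent_image: "inj_on h X \<Longrightarrow> ent (h ` X) f = ent X (\<lambda>x. f (h x))"
  by (simp add: ent_def sum.reindex card_image)

section \<open>Combinatorics of exchanges on sets of fixed size\<close>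

lemma finite_ksubsets [simp]: "finite I \<Longrightarrow> finite (ksubsets I r)"
  by (rule finite_subset[of _ "Pow I"]) (auto simp: ksubsets_def)

lemma finite_swaps [simp]: "finite I \<Longrightarrow> finite (swaps I r)"
  by (auto simp: swaps_def ksubsets_def intro!: finite_SigmaI finite_subset[of _ I] finite_ksubsets[unfolded ksubsets_def])

lemma mem_swaps: "(S, a, b) \<in> swaps I r \<longleftrightarrow> S \<in> ksubsets I r \<and> a \<in> S \<and> b \<in> I \<and> b \<notin> S"
  by (auto simp: swaps_def)

lemma swap_in_ksubsets:
  assumes "finite I" "(S, a, b) \<in> swaps I r" shows "swap a b S \<in> ksubsets I r"
proof -
  have "finite S" using assms finite_subset by (auto simp: mem_swaps ksubsets_def)
  then have "card (insert b (S - {a})) = Suc (card S - 1)" 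
    using assms by (subst card_insert_disjoint) (auto simp: mem_swaps)
  moreover have "card S > 0" using assms \<open>finite S\<close> by (auto simp: mem_swaps card_gt_0_iff)
  ultimately show ?thesis using assms by (auto simp: mem_swaps ksubsets_def swap_def)
qed

lemma swap_swap: "a \<in> S \<Longrightarrow> b \<notin> S \<Longrightarrow> swap b a (swap a b S) = S"
  by (auto simp: swap_def)

text \<open>Reversing the exchange is an involution on \<open>swaps I r\<close> that interchanges
  the old and the new set.\<close>

lemma sum_swaps_flip:
  assumes "finite I"
  shows "(\<Sum>(S,a,b)\<in>swaps I r. h S (swap a b S)) = (\<Sum>(S,a,b)\<in>swaps I r. h (swap a b S) S)"
  by (rule sum.reindex_bij_witness[of _ "\<lambda>(S,a,b). (swap a b S, b, a)" "\<lambda>(S,a,b). (swap a b S, b, a)"])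
    (use swap_in_ksubsets[OF assms] in \<open>auto simp: mem_swaps swap_swap\<close>, auto simp: swap_def ksubsets_def)

lemma ksubsets_with:
  assumes "finite I" "i \<in> I" "r > 0"
  shows "{S \<in> ksubsets I r. i \<in> S} = insert i ` ksubsets (I - {i}) (r - 1)"
proof (intro equalityI subsetI)
  fix S assume S: "S \<in> {S \<in> ksubsets I r. i \<in> S}"
  then have "S - {i} \<in> ksubsets (I - {i}) (r - 1)" "S = insert i (S - {i})"
    using assms by (auto simp: ksubsets_def)
  then show "S \<in> insert i ` ksubsets (I - {i}) (r - 1)" by blast
next
  fix S assume "S \<in> insert i ` ksubsets (I - {i}) (r - 1)"
  then obtain T where T: "S = insert i T" "T \<subseteq> I - {i}" "card T = r - 1" by (auto simp: ksubsets_def)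
  then have "card S = Suc (card T)"
    using assms finite_subset[of T "I - {i}"] by (auto simp: card_insert_if)
  then show "S \<in> {S \<in> ksubsets I r. i \<in> S}" using T assms by (auto simp: ksubsets_def)
qed

lemma ksubsets_without: "{S \<in> ksubsets I r. i \<notin> S} = ksubsets (I - {i}) r"
  by (auto simp: ksubsets_def)

lemma inj_on_insert_ksubsets: "inj_on (insert i) (ksubsets (I - {i}) r)"
  by (auto simp: inj_on_def ksubsets_def)

text \<open>The sets containing \<open>i\<close> form a smaller slice, on \<open>I - {i}\<close>
  with size \<open>r - 1\<close>; its exchanges are exactly the original ones that stay within this
  fibre.\<close>

lemma sum_swaps_with:
  assumes "finite I" "i \<in> I" "r > 0"
  shows "(\<Sum>(S,a,b)\<in>swaps (I - {i}) (r - 1). h (insert i S) (insert i (swap a b S)))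
    = (\<Sum>(S,a,b)\<in>{(S,a,b) \<in> swaps I r. i \<in> S \<and> a \<noteq> i}. h S (swap a b S))"
proof (rule sum.reindex_bij_witness[of _ "\<lambda>(S,a,b). (S - {i}, a, b)" "\<lambda>(S,a,b). (insert i S, a, b)"])
  fix x assume "x \<in> swaps (I - {i}) (r - 1)"
  then obtain S a b where x: "x = (S,a,b)" "S \<in> ksubsets (I - {i}) (r - 1)" "a \<in> S" "b \<in> I - {i}" "b \<notin> S"
    by (cases x) (auto simp: mem_swaps)
  then have "insert i S \<in> ksubsets I r" using ksubsets_with[OF assms] by blast
  then show "(case x of (S,a,b) \<Rightarrow> (insert i S, a, b)) \<in> {(S,a,b) \<in> swaps I r. i \<in> S \<and> a \<noteq> i}"
    using x by (auto simp: mem_swaps ksubsets_def)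
  show "(case case x of (S,a,b) \<Rightarrow> (insert i S, a, b) of (S,a,b) \<Rightarrow> (S - {i}, a, b)) = x"
    using x by (auto simp: ksubsets_def)
  have "swap a b (insert i S) = insert i (swap a b S)" using x by (auto simp: swap_def ksubsets_def)
  then show "(case case x of (S,a,b) \<Rightarrow> (insert i S, a, b) of (S,a,b) \<Rightarrow> h S (swap a b S))
    = (case x of (S,a,b) \<Rightarrow> h (insert i S) (insert i (swap a b S)))" using x by simp
next
  fix y assume "y \<in> {(S,a,b) \<in> swaps I r. i \<in> S \<and> a \<noteq> i}"
  then obtain S a b where y: "y = (S,a,b)" "S \<in> ksubsets I r" "i \<in> S" "a \<in> S" "a \<noteq> i" "b \<in> I" "b \<notin> S"
    by (cases y) (auto simp: mem_swaps)
  then show "(case case y of (S,a,b) \<Rightarrow> (S - {i}, a, b) of (S,a,b) \<Rightarrow> (insert i S, a, b)) = y"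
    by auto
  show "(case y of (S,a,b) \<Rightarrow> (S - {i}, a, b)) \<in> swaps (I - {i}) (r - 1)"
    using y by (auto simp: mem_swaps ksubsets_def)
qed

text \<open>A set \<open>T\<close> avoiding \<open>i\<close> is reached once for each of its
  \<open>r\<close> elements \<open>b\<close>, namely from the set in which \<open>i\<close> stands
  in place of \<open>b\<close>.\<close>

lemma sum_swap_fixed:
  fixes h :: "'a set \<Rightarrow> real"
  assumes "finite I" "i \<in> I"
  shows "(\<Sum>(S,b)\<in>(SIGMA S:{S \<in> ksubsets I r. i \<in> S}. I - S). h (swap i b S))
    = real r * (\<Sum>T\<in>{S \<in> ksubsets I r. i \<notin> S}. h T)"
proof -
  have "(\<Sum>(S,b)\<in>(SIGMA S:{S \<in> ksubsets I r. i \<in> S}. I - S). h (swap i b S))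
    = (\<Sum>(T,b)\<in>(SIGMA T:{S \<in> ksubsets I r. i \<notin> S}. T). h T)"
  proof (rule sum.reindex_bij_witness[of _ "\<lambda>(T,b). (swap b i T, b)" "\<lambda>(S,b). (swap i b S, b)"])
    fix x assume "x \<in> (SIGMA S:{S \<in> ksubsets I r. i \<in> S}. I - S)"
    then obtain S b where x: "x = (S,b)" "(S, i, b) \<in> swaps I r" by (auto simp: mem_swaps)
    then show "(case x of (S,b) \<Rightarrow> (swap i b S, b)) \<in> (SIGMA T:{S \<in> ksubsets I r. i \<notin> S}. T)"
      using swap_in_ksubsets[OF assms(1) x(2)] by (auto simp: swap_def mem_swaps)
    show "(case case x of (S,b) \<Rightarrow> (swap i b S, b) of (T,b) \<Rightarrow> (swap b i T, b)) = x"
      using x by (simp add: swap_swap mem_swaps)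
    show "(case case x of (S,b) \<Rightarrow> (swap i b S, b) of (T,b) \<Rightarrow> h T) = (case x of (S,b) \<Rightarrow> h (swap i b S))"
      by (simp add: x)
  next
    fix y assume "y \<in> (SIGMA T:{S \<in> ksubsets I r. i \<notin> S}. T)"
    then obtain T b where y: "y = (T,b)" "(T, b, i) \<in> swaps I r" using assms by (auto simp: mem_swaps)
    then show "(case y of (T,b) \<Rightarrow> (swap b i T, b)) \<in> (SIGMA S:{S \<in> ksubsets I r. i \<in> S}. I - S)"
      using swap_in_ksubsets[OF assms(1) y(2)] by (auto simp: swap_def mem_swaps ksubsets_def)
    show "(case case y of (T,b) \<Rightarrow> (swap b i T, b) of (S,b) \<Rightarrow> (swap i b S, b)) = y"
      using y by (simp add: swap_swap mem_swaps)
  qed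
  also have "\<dots> = (\<Sum>T\<in>{S \<in> ksubsets I r. i \<notin> S}. \<Sum>b\<in>T. h T)"
    using assms by (intro sum.Sigma[symmetric]) (auto simp: ksubsets_def intro: finite_subset)
  also have "\<dots> = real r * (\<Sum>T\<in>{S \<in> ksubsets I r. i \<notin> S}. h T)"
    by (simp add: sum_distrib_left ksubsets_def)
  finally show ?thesis .
qed

lemma sum_fixed_source:
  fixes h :: "'a set \<Rightarrow> real"
  assumes "finite I" 
  shows "(\<Sum>(S,b)\<in>(SIGMA S:{S \<in> ksubsets I r. i \<in> S}. I - S). h S)
    = real (card I - r) * (\<Sum>S\<in>{S \<in> ksubsets I r. i \<in> S}. h S)"
proof -
  have "(\<Sum>(S,b)\<in>(SIGMA S:{S \<in> ksubsets I r. i \<in> S}. I - S). h S)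
      = (\<Sum>S\<in>{S \<in> ksubsets I r. i \<in> S}. \<Sum>b\<in>I - S. h S)"
    using assms by (intro sum.Sigma[symmetric]) auto
  also have "\<dots> = (\<Sum>S\<in>{S \<in> ksubsets I r. i \<in> S}. real (card I - r) * h S)"
    using assms by (intro sum.cong) (auto simp: ksubsets_def card_Diff_subset finite_subset)
  finally show ?thesis by (simp add: sum_distrib_left)
qed

section \<open>Comparison of fibres and induction over coordinates\<close>

lemma swaps_pos:
  assumes "finite I" "\<And>S. S \<in> ksubsets I r \<Longrightarrow> f S > 0" "(S, a, b) \<in> swaps I r"
  shows "f S > 0 \<and> f (swap a b S) > 0"
  using assms swap_in_ksubsets[of I S a b r] by (auto simp: mem_swaps)

lemma dform_nonneg: "x > 0 \<Longrightarrow> y > 0 \<Longrightarrow> dform x y \<ge> 0"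
  unfolding dform_def by (cases "x \<le> y") (auto simp: mult_nonpos_nonpos)

text \<open>A uniform pair \<open>(S, b)\<close> in \<open>P\<close> couples the uniform measures on
  the two fibres through \<open>S\<close> and \<open>swap i b S\<close>. Hence both fibre means are
  averages over the same index set \<open>P\<close>, and \<open>dform_sum\<close> bounds their
  \<open>dform\<close> by the exchanges that remove \<open>i\<close>.\<close>

lemma dform_fibres_le:
  fixes f :: "'a set \<Rightarrow> real"
  assumes I: "finite I" "i \<in> I" and r: "0 < r" "r < card I"
    and pos: "\<And>S. S \<in> ksubsets I r \<Longrightarrow> f S > 0"
  defines "X \<equiv> {S \<in> ksubsets I r. i \<in> S}" and "Y \<equiv> {S \<in> ksubsets I r. i \<notin> S}"
  shows "X \<noteq> {}" "Y \<noteq> {}"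
    "card I * (real (card X) * card Y / (real (card X) + card Y)
        * dform (sum f X / card X) (sum f Y / card Y))
      \<le> (\<Sum>(S,a,b)\<in>{(S,a,b) \<in> swaps I r. a = i}. dform (f S) (f (swap a b S)))"
proof -
  define P where "P = (SIGMA S:X. I - S)"
  have "r \<le> card (I - {i})" using r I by simp
  then obtain T where T: "T \<subseteq> I - {i}" "card T = r" by (rule obtain_subset_with_card_n)
  then have TY: "T \<in> Y" by (auto simp: Y_def ksubsets_def)
  then show Y: "Y \<noteq> {}" by blast
  obtain b where b: "b \<in> T" using T r by fastforce
  then have Tsw: "(T, b, i) \<in> swaps I r" using TY I by (auto simp: mem_swaps Y_def)
  have sX: "swap b i T \<in> X"
    using swap_in_ksubsets[OF I(1) Tsw] by (auto simp: X_def swap_def)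
  then show X: "X \<noteq> {}" by blast
  have b': "b \<in> I - swap b i T" using Tsw T b by (auto simp: swap_def)
  then have P: "P \<noteq> {}" using sX by (auto simp: P_def)
  have fin: "finite X" "finite Y" "finite P" using I by (auto simp: X_def Y_def P_def)
  have memP: "(S, i, b) \<in> swaps I r" if "(S, b) \<in> P" for S b
    using that by (auto simp: P_def X_def mem_swaps)
  \<comment> \<open>\<open>M\<close> is the number of pairs in \<open>P\<close>, counted below from
    either fibre.\<close>
  define M where "M = real (card I - r) * card X"
  have M2: "M = real r * card Y"
  proof -
    have "real (card I - r) * card X = (\<Sum>(S,b)\<in>P. 1)"
      using sum_fixed_source[OF I(1), of "\<lambda>_. 1" r i] by (simp add: P_def X_def)
    also have "\<dots> = real r * card Y"
      using sum_swap_fixed[OF I, of "\<lambda>_. 1" r] by (simp add: P_def X_def Y_def)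
    finally show ?thesis by (simp add: M_def)
  qed
  have cX: "real (card X) > 0" and cY: "real (card Y) > 0" using X Y fin by (auto simp: card_gt_0_iff)
  have M0: "M > 0" unfolding M_def using cX r by simp
  have fX: "sum f X > 0" and fY: "sum f Y > 0"
    using X Y fin pos by (auto intro!: sum_pos simp: X_def Y_def)
  have sums: "(\<Sum>(S,b)\<in>P. f S) = real (card I - r) * sum f X" 
      "(\<Sum>(S,b)\<in>P. f (swap i b S)) = real r * sum f Y"
    using sum_fixed_source[OF I(1), of f r i] sum_swap_fixed[OF I, of f r]
    by (auto simp: P_def X_def Y_def)
  have "dform (\<Sum>(S,b)\<in>P. f S) (\<Sum>(S,b)\<in>P. f (swap i b S))
     \<le> (\<Sum>p\<in>P. dform (case p of (S,b) \<Rightarrow> f S) (case p of (S,b) \<Rightarrow> f (swap i b S)))"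
    using swaps_pos[of I r f, OF I(1) pos memP] by (intro dform_sum fin P) auto
  also have "\<dots> = (\<Sum>(S,a,b)\<in>{(S,a,b) \<in> swaps I r. a = i}. dform (f S) (f (swap a b S)))"
    by (rule sum.reindex_bij_witness[of _ "\<lambda>(S,a,b). (S,b)" "\<lambda>(S,b). (S,i,b)"])
       (auto simp: P_def X_def mem_swaps)
  finally have D: "dform (real (card I - r) * sum f X) (real r * sum f Y)
      \<le> (\<Sum>(S,a,b)\<in>{(S,a,b) \<in> swaps I r. a = i}. dform (f S) (f (swap a b S)))"
    by (simp add: sums)
  have u: "real (card I - r) > 0" "real r > 0" using r by auto
  have "sum f X / card X = real (card I - r) * sum f X / M" "sum f Y / card Y = real r * sum f Y / M"
    subgoal using u cX by (simp add: M_def)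
    subgoal using u cY by (simp add: M2)
    done
  then have scaled: "dform (sum f X / card X) (sum f Y / card Y)
      = dform (real (card I - r) * sum f X) (real r * sum f Y) / M"
    using M0 fX fY u by (simp add: dform_divide)
  define K where "K = real (card X) * card Y / (real (card X) + card Y)"
  \<comment> \<open>Splitting \<open>card I\<close> as \<open>r\<close> plus
    \<open>card I - r\<close> and using both counts of \<open>M\<close> makes the prefactor match
    exactly, with no loss.\<close>
  have K: "card I * K = M"
  proof -
    have "card I = real r + real (card I - r)" using r by (simp add: of_nat_diff)
    then have "card I * (real (card X) * card Y)
       = (real r + real (card I - r)) * (real (card X) * card Y)" by (rule arg_cong)
    also have "\<dots> = card X * (real r * card Y) + (real (card I - r) * card X) * card Y"
      by (simp only: algebra_simps)
    also have "\<dots> = M * (real (card X) + card Y)" 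
      unfolding M2[symmetric] M_def[symmetric] by (simp only: algebra_simps)
    finally show ?thesis using cX cY by (simp add: K_def divide_eq_eq)
  qed
  have "card I * (K * dform (sum f X / card X) (sum f Y / card Y))
     = (card I * K) * dform (sum f X / card X) (sum f Y / card Y)"
    by (rule mult.assoc[symmetric])
  also have "\<dots> = dform (real (card I - r) * sum f X) (real r * sum f Y)"
    unfolding K scaled using M0 by simp
  finally show "card I * (real (card X) * card Y / (real (card X) + card Y)
        * dform (sum f X / card X) (sum f Y / card Y))
      \<le> (\<Sum>(S,a,b)\<in>{(S,a,b) \<in> swaps I r. a = i}. dform (f S) (f (swap a b S)))"
    using D by (simp only: K_def)
qed

lemma ksubsets_0: "finite I \<Longrightarrow> ksubsets I 0 = {{}}"
  by (auto simp: ksubsets_def finite_subset)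

lemma ksubsets_full: "finite I \<Longrightarrow> ksubsets I (card I) = {I}"
  using card_subset_eq by (auto simp: ksubsets_def)

lemma ksubsets_big: "finite I \<Longrightarrow> r > card I \<Longrightarrow> ksubsets I r = {}"
  by (auto simp: ksubsets_def dest: card_mono)

text \<open>The chain rule is summed over all splitting coordinates \<open>i\<close>. With
  \<open>card I = m + 1\<close>, the induction hypothesis on the fibres contributes
  \<open>(m - 1) / m\<close> times the full form, and the terms between fibres contribute
  \<open>1 / (m + 1)\<close>; these weights add up to at most 1, so the constant does not
  grow.\<close>

lemma modified_log_sobolev_slice:
  fixes f :: "'a set \<Rightarrow> real"
  assumes "finite I" and "\<And>S. S \<in> ksubsets I r \<Longrightarrow> f S > 0"
  shows "card I * ent (ksubsets I r) f \<le> (\<Sum>(S,a,b)\<in>swaps I r. dform (f S) (f (swap a b S)))"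
  using assms
proof (induction "card I" arbitrary: I r f)
  case 0
  then show ?case by (auto simp: swaps_def)
next
  case (Suc m I r f)
  note I = \<open>finite I\<close> and pos = Suc.prems(2)
  define D where "D = (\<lambda>(S,a,b). dform (f S) (f (swap a b S)))"
  have D0: "D q \<ge> 0" if "q \<in> swaps I r" for q
    using swaps_pos[of I r f, OF I pos] that by (cases q) (auto simp: D_def intro!: dform_nonneg)
  show ?case
  proof (cases "0 < r \<and> r < card I")
    \<comment> \<open>In these cases the family has at most one member, so its entropy is
      zero.\<close>
    case False
    then have "ent (ksubsets I r) f = 0"
      using I by (cases r "card I" rule: linorder_cases) (auto simp: ksubsets_0 ksubsets_full ksubsets_big)
    then show ?thesis using D0 by (auto simp: D_def intro!: sum_nonneg)
  next
    case True
    then have m: "m > 0" using Suc.hyps(2) by simp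
    define X Y where "X i = {S \<in> ksubsets I r. i \<in> S}" and "Y i = {S \<in> ksubsets I r. i \<notin> S}" for i
    define R where "R i = real (card (X i)) * card (Y i) / (real (card (X i)) + card (Y i))
        * dform (sum f (X i) / card (X i)) (sum f (Y i) / card (Y i))" for i
    have chain: "ent (ksubsets I r) f \<le> ent (X i) f + ent (Y i) f + R i" if "i \<in> I" for i
    proof -
      have "ksubsets I r = X i \<union> Y i" by (auto simp: X_def Y_def)
      moreover have "ent (X i \<union> Y i) f \<le> ent (X i) f + ent (Y i) f + R i"
        unfolding R_def
        using dform_fibres_le(1,2)[OF I that, of r f] True pos I
        by (intro ent_Un_disjoint_le) (auto simp: X_def Y_def)
      ultimately show ?thesis by simp
    qed
    have fib: "m * (ent (X i) f + ent (Y i) f) \<le> (\<Sum>q\<in>{q \<in> swaps I r. i \<notin> {fst (snd q), snd (snd q)}}. D q)"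
      if i: "i \<in> I" for i
    proof -
      have cm: "m = card (I - {i})" using Suc.hyps(2) I i by simp
      have "m * ent (X i) f = m * ent (ksubsets (I - {i}) (r - 1)) (\<lambda>S. f (insert i S))"
        using ksubsets_with[OF I i, of r] True inj_on_insert_ksubsets[of i I "r - 1"]
        by (simp add: X_def ent_image)
      also have "\<dots> \<le> (\<Sum>(S,a,b)\<in>swaps (I - {i}) (r - 1). dform (f (insert i S)) (f (insert i (swap a b S))))"
        unfolding cm
      proof (rule Suc.hyps(1)[OF cm])
        show "f (insert i S) > 0" if "S \<in> ksubsets (I - {i}) (r - 1)" for S
          using ksubsets_with[OF I i, of r] True that pos by blast
      qed (use I in auto)
      also have "\<dots> = (\<Sum>q\<in>{(S,a,b) \<in> swaps I r. i \<in> S \<and> a \<noteq> i}. D q)"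
        using sum_swaps_with[OF I i, of r "\<lambda>S T. dform (f S) (f T)"] True by (simp add: D_def)
      finally have 1: "m * ent (X i) f \<le> (\<Sum>q\<in>{(S,a,b) \<in> swaps I r. i \<in> S \<and> a \<noteq> i}. D q)" .
      have "m * ent (Y i) f \<le> (\<Sum>q\<in>swaps (I - {i}) r. D q)"
        unfolding cm Y_def ksubsets_without D_def
        by (rule Suc.hyps(1)[OF cm]) (use I pos in \<open>auto simp: ksubsets_def\<close>)
      moreover have "swaps (I - {i}) r = {(S,a,b) \<in> swaps I r. i \<notin> S \<and> b \<noteq> i}"
        by (auto simp: mem_swaps ksubsets_def)
      ultimately have "m * (ent (X i) f + ent (Y i) f) \<le>
          (\<Sum>q\<in>{(S,a,b) \<in> swaps I r. i \<in> S \<and> a \<noteq> i}. D q)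
        + (\<Sum>q\<in>{(S,a,b) \<in> swaps I r. i \<notin> S \<and> b \<noteq> i}. D q)"
        using 1 by (simp add: distrib_left)
      also have "\<dots> = (\<Sum>q\<in>{(S,a,b) \<in> swaps I r. i \<in> S \<and> a \<noteq> i} \<union> {(S,a,b) \<in> swaps I r. i \<notin> S \<and> b \<noteq> i}. D q)"
        by (intro sum.union_disjoint[symmetric] finite_subset[OF _ finite_swaps[OF I]]) auto
      also have "{(S,a,b) \<in> swaps I r. i \<in> S \<and> a \<noteq> i} \<union> {(S,a,b) \<in> swaps I r. i \<notin> S \<and> b \<noteq> i}
          = {q \<in> swaps I r. i \<notin> {fst (snd q), snd (snd q)}}"
        by (auto simp: mem_swaps)
      finally show ?thesis .
    qed
    have "(\<Sum>i\<in>I. real m * (ent (X i) f + ent (Y i) f))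
        \<le> (\<Sum>i\<in>I. \<Sum>q\<in>{q \<in> swaps I r. i \<notin> {fst (snd q), snd (snd q)}}. D q)"
      by (rule sum_mono) (rule fib)
    also have "\<dots> = (\<Sum>q\<in>swaps I r. \<Sum>i\<in>{i \<in> I. i \<notin> {fst (snd q), snd (snd q)}}. D q)"
      using I by (intro sum.swap_restrict) auto
    also have "\<dots> = (\<Sum>q\<in>swaps I r. (real m - 1) * D q)"
    proof (rule sum.cong[OF refl])
      fix q assume q: "q \<in> swaps I r"
      \<comment> \<open>A swap moves two distinct elements and so lies within a fibre for the other
        \<open>m - 1\<close> choices of \<open>i\<close>.\<close>
      have "{i \<in> I. i \<notin> {fst (snd q), snd (snd q)}} = I - {fst (snd q), snd (snd q)}" by auto
      moreover have "fst (snd q) \<noteq> snd (snd q)" "{fst (snd q), snd (snd q)} \<subseteq> I"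
        using q by (auto simp: swaps_def ksubsets_def)
      then have "card (I - {fst (snd q), snd (snd q)}) = m - 1"
        using Suc.hyps(2) by (simp add: card_Diff_subset)
      ultimately show "(\<Sum>i\<in>{i \<in> I. i \<notin> {fst (snd q), snd (snd q)}}. D q) = (real m - 1) * D q"
        using m by (simp add: of_nat_diff)
    qed
    finally have F: "m * (\<Sum>i\<in>I. ent (X i) f + ent (Y i) f) \<le> (real m - 1) * sum D (swaps I r)"
      by (simp add: sum_distrib_left)
    have "(\<Sum>i\<in>I. Suc m * R i) \<le> (\<Sum>i\<in>I. \<Sum>q\<in>{q \<in> swaps I r. fst (snd q) = i}. D q)"
    proof (rule sum_mono)
      fix i assume i: "i \<in> I"
      have "{(S,a,b) \<in> swaps I r. a = i} = {q \<in> swaps I r. fst (snd q) = i}" by auto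
      then show "Suc m * R i \<le> (\<Sum>q\<in>{q \<in> swaps I r. fst (snd q) = i}. D q)"
        using dform_fibres_le(3)[OF I i, of r f] True pos Suc.hyps(2)
        by (simp add: R_def X_def Y_def D_def)
    qed
    \<comment> \<open>Each swap removes exactly one element, so the index sets for different
      \<open>i\<close> partition all swaps.\<close>
    also have "\<dots> = sum D (swaps I r)"
      using finite_swaps[OF I] by (intro sum.group I) (auto simp: swaps_def ksubsets_def)
    finally have R: "Suc m * (\<Sum>i\<in>I. R i) \<le> sum D (swaps I r)"
      by (simp add: sum_distrib_left)
    have "Suc m * ent (ksubsets I r) f = (\<Sum>i\<in>I. ent (ksubsets I r) f)"
      using Suc.hyps(2) by simp
    also have "\<dots> \<le> (\<Sum>i\<in>I. ent (X i) f + ent (Y i) f + R i)"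
      by (rule sum_mono) (rule chain)
    also have "\<dots> = (\<Sum>i\<in>I. ent (X i) f + ent (Y i) f) + (\<Sum>i\<in>I. R i)"
      by (simp add: sum.distrib)
    also have "\<dots> \<le> (real m - 1) / m * sum D (swaps I r) + sum D (swaps I r) / Suc m"
      using F R m by (intro add_mono) (simp_all add: field_simps)
    also have "\<dots> = ((real m - 1) / m + 1 / Suc m) * sum D (swaps I r)"
      by (simp add: algebra_simps)
    also have "\<dots> \<le> 1 * sum D (swaps I r)"
    proof (rule mult_right_mono)
      have "(real m - 1) / m = 1 - 1 / m" using m by (simp add: diff_divide_distrib)
      moreover have "1 / real (Suc m) \<le> 1 / m" using m by (intro divide_left_mono) auto
      ultimately show "(real m - 1) / m + 1 / Suc m \<le> 1" by linarith
      show "0 \<le> sum D (swaps I r)" by (rule sum_nonneg) (rule D0)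
    qed
    finally show ?thesis using Suc.hyps(2) by (simp add: D_def)
  qed
qed

section \<open>Herbst argument\<close>

text \<open>\<open>t \<psi>' - \<psi> \<le> C t\<^sup>2 \<psi>'\<close> says exactly that \<open>\<psi> t / t - C \<psi> t\<close> is decreasing, also across \<open>t = 0\<close>;
  comparing positive and negative \<open>t\<close> eliminates the mean \<open>\<psi>' 0\<close>.\<close>
lemma herbst:
  fixes g :: "'a \<Rightarrow> real" and C L T :: real
  assumes X: "finite X" "X \<noteq> {}" and LT: "0 < L" "0 < T"
    and ent: "\<And>t. -L \<le> t \<Longrightarrow> t \<le> T \<Longrightarrow>
      ent X (\<lambda>x. exp (t * g x)) \<le> C * t\<^sup>2 * (\<Sum>x\<in>X. g x * exp (t * g x))"
  defines "\<psi> \<equiv> \<lambda>t. ln ((\<Sum>x\<in>X. exp (t * g x)) / card X)"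
  shows "\<psi> T / T - C * \<psi> T \<le> \<psi> (-L) / (-L) - C * \<psi> (-L)"
proof -
  define F where "F t = (\<Sum>x\<in>X. exp (t * g x))" for t
  define P where "P t = (\<Sum>x\<in>X. g x * exp (t * g x))" for t
  have F: "F t > 0" for t unfolding F_def using X by (intro sum_pos) auto
  have c: "real (card X) > 0" using X by (simp add: card_gt_0_iff)
  have \<psi>: "\<psi> t = ln (F t / card X)" for t by (simp add: \<psi>_def F_def)
  have d\<psi>: "(\<psi> has_real_derivative P t / F t) (at t)" for t
  proof -
    have "(F has_real_derivative P t) (at t)"
      unfolding F_def P_def by (auto intro!: derivative_eq_intros sum.cong)
    then have "((\<lambda>t. ln (F t / card X)) has_real_derivative P t / F t) (at t)"
      using F[of t] c by (auto intro!: derivative_eq_intros simp: field_simps)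
    then show ?thesis by (simp add: \<psi>[abs_def])
  qed
  have \<psi>0: "\<psi> 0 = 0" using c by (simp add: \<psi> F_def)
  \<comment> \<open>The value at 0 uses \<psi>'(0) = \<open>P 0 / F 0\<close>, the limit of
    \<psi>(t) / t, which makes \<open>q\<close> continuous there.\<close>
  define q where "q t = (if t = 0 then P 0 / F 0 else \<psi> t / t) - C * \<psi> t" for t
  have dq: "(q has_real_derivative (P t / F t * t - \<psi> t) / t\<^sup>2 - C * (P t / F t)) (at t)" if "t \<noteq> 0" for t
  proof -
    have "((\<lambda>t. \<psi> t / t - C * \<psi> t) has_real_derivative (P t / F t * t - \<psi> t) / t\<^sup>2 - C * (P t / F t)) (at t)"
      using that by (auto intro!: derivative_eq_intros d\<psi> simp: power2_eq_square)
    then show ?thesis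
    proof (rule DERIV_cong_ev[THEN iffD1, OF refl _ refl, rotated])
      show "\<forall>\<^sub>F x in nhds t. \<psi> x / x - C * \<psi> x = q x"
        using t1_space_nhds[OF that] by (rule eventually_mono) (simp add: q_def)
    qed
  qed
  have le: "(P t / F t * t - \<psi> t) / t\<^sup>2 - C * (P t / F t) \<le> 0" if "-L \<le> t" "t \<le> T" "t \<noteq> 0" for t
  proof -
    \<comment> \<open>Since \<psi>' = \<open>P / F\<close>, the entropy of the exponential is
      \<open>F\<close> times t \<psi>' - \<psi>, the numerator in the derivative of \<psi>(t) /
      t.\<close>
    have "ent X (\<lambda>x. exp (t * g x)) = t * P t - F t * \<psi> t"
      by (simp add: ent_def \<psi> flip: F_def) (simp add: P_def sum_distrib_left mult_ac)
    then have "t * P t - F t * \<psi> t \<le> C * t\<^sup>2 * P t" using ent[OF that(1,2)] by (simp add: P_def)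
    then have "(t * P t - F t * \<psi> t) / (F t * t\<^sup>2) \<le> C * t\<^sup>2 * P t / (F t * t\<^sup>2)"
      using F[of t] by (intro divide_right_mono) auto
    moreover have "(t * P t - F t * \<psi> t) / (F t * t\<^sup>2) = (P t / F t * t - \<psi> t) / t\<^sup>2"
      using F[of t] that by (simp add: field_simps)
    ultimately show ?thesis using F[of t] that by simp
  qed
  have "isCont q t" for t
  proof (cases "t = 0")
    case True
    have "((\<lambda>h. (\<psi> (0 + h) - \<psi> 0) / h) \<longlongrightarrow> P 0 / F 0) (at 0)"
      using d\<psi>[of 0] by (simp add: DERIV_def)
    then have "((\<lambda>h. \<psi> h / h) \<longlongrightarrow> P 0 / F 0) (at 0)" by (simp add: \<psi>0)
    then have "((\<lambda>h. if h = 0 then P 0 / F 0 else \<psi> h / h) \<longlongrightarrow> P 0 / F 0) (at 0)"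
      by (rule Lim_transform_eventually) (auto simp: eventually_at intro!: exI[of _ 1])
    then have "isCont (\<lambda>h. if h = 0 then P 0 / F 0 else \<psi> h / h) 0" by (simp add: isCont_def)
    moreover have "isCont \<psi> 0" using d\<psi> DERIV_isCont by blast
    ultimately show ?thesis unfolding q_def[abs_def] True by (intro continuous_intros)
  qed (use dq DERIV_isCont in blast)
  then have cont: "continuous_on A q" for A by (simp add: continuous_at_imp_continuous_on)
  \<comment> \<open>Only interior derivatives are required, so 0 may be an endpoint of the interval;
    the two sides are joined by continuity at 0.\<close>
  have step: "q v \<le> q u" if "-L \<le> u" "u \<le> v" "v \<le> T" "0 \<notin> {u<..<v}" for u v
  proof (rule DERIV_nonpos_imp_decreasing_open[OF \<open>u \<le> v\<close> _ cont])
    fix t assume t: "u < t" "t < v"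
    then have "t \<noteq> 0" "-L \<le> t" "t \<le> T" using that by auto
    then show "\<exists>y. (q has_real_derivative y) (at t) \<and> y \<le> 0" using dq le by blast
  qed
  have "q T \<le> q 0" using step[of 0 T] LT by simp
  also have "q 0 \<le> q (-L)" using step[of "-L" 0] LT by simp
  finally show ?thesis using LT by (simp add: q_def)
qed

section \<open>Talagrand's convex distance\<close>

lemma weighted_dist_le:
  "w \<in> A \<Longrightarrow> weighted_dist n \<alpha> \<omega> A \<le> (\<Sum>i=1..n. \<bar>\<alpha> i\<bar> * of_bool (\<omega> i \<noteq> w i))"
  unfolding weighted_dist_def by (rule cINF_lower) (auto intro!: bdd_belowI[of _ 0] sum_nonneg)

lemma le_weighted_dist:
  "A \<noteq> {} \<Longrightarrow> (\<And>w. w \<in> A \<Longrightarrow> c \<le> (\<Sum>i=1..n. \<bar>\<alpha> i\<bar> * of_bool (\<omega> i \<noteq> w i)))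
    \<Longrightarrow> c \<le> weighted_dist n \<alpha> \<omega> A"
  unfolding weighted_dist_def by (rule cINF_greatest)

lemma weighted_dist_nonneg: "A \<noteq> {} \<Longrightarrow> weighted_dist n \<alpha> \<omega> A \<ge> 0"
  by (auto intro!: le_weighted_dist sum_nonneg)

lemma weighted_dist_zero: "w \<in> A \<Longrightarrow> (\<And>i. i \<in> {1..n} \<Longrightarrow> \<alpha> i = 0) \<Longrightarrow> weighted_dist n \<alpha> \<omega> A \<le> 0"
  using weighted_dist_le[of w A n \<alpha> \<omega>] by simp

text \<open>The two changed coordinates are charged in full, and the rest cannot see the change.
  They are also deleted from \<alpha>, because the smaller norm of the remainder is exploited in
  \<open>convex_dist_modify\<close>.\<close>

lemma weighted_dist_modify:
  assumes "A \<noteq> {}" "a \<in> {1..n}" "b \<in> {1..n}" "a \<noteq> b"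
    and "\<And>i. i \<in> {1..n} \<Longrightarrow> i \<noteq> a \<Longrightarrow> i \<noteq> b \<Longrightarrow> \<omega> i = \<omega>' i"
  shows "weighted_dist n \<alpha> \<omega> A
    \<le> \<bar>\<alpha> a\<bar> + \<bar>\<alpha> b\<bar> + weighted_dist n (\<alpha>(a := 0, b := 0)) \<omega>' A"
proof -
  have "weighted_dist n \<alpha> \<omega> A - (\<bar>\<alpha> a\<bar> + \<bar>\<alpha> b\<bar>) \<le> weighted_dist n (\<alpha>(a := 0, b := 0)) \<omega>' A"
  proof (rule le_weighted_dist[OF assms(1)])
    fix w assume "w \<in> A"
    then have "weighted_dist n \<alpha> \<omega> A \<le> (\<Sum>i=1..n. \<bar>\<alpha> i\<bar> * of_bool (\<omega> i \<noteq> w i))"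
      by (rule weighted_dist_le)
    also have "\<dots> \<le> (\<Sum>i=1..n. (if i = a then \<bar>\<alpha> i\<bar> else 0) + (if i = b then \<bar>\<alpha> i\<bar> else 0)
        + \<bar>(\<alpha>(a := 0, b := 0)) i\<bar> * of_bool (\<omega>' i \<noteq> w i))"
      using assms(4,5) by (intro sum_mono) auto
    also have "\<dots> = \<bar>\<alpha> a\<bar> + \<bar>\<alpha> b\<bar> + (\<Sum>i=1..n. \<bar>(\<alpha>(a := 0, b := 0)) i\<bar> * of_bool (\<omega>' i \<noteq> w i))"
      using assms(2,3) by (simp add: sum.distrib del: fun_upd_apply)
    finally show "weighted_dist n \<alpha> \<omega> A - (\<bar>\<alpha> a\<bar> + \<bar>\<alpha> b\<bar>)
      \<le> (\<Sum>i=1..n. \<bar>(\<alpha>(a := 0, b := 0)) i\<bar> * of_bool (\<omega>' i \<noteq> w i))" by simp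
  qed
  then show ?thesis by simp
qed

lemma bdd_above_weighted_dist:
  assumes "A \<noteq> {}"
  shows "bdd_above ((\<lambda>\<alpha>. weighted_dist n \<alpha> \<omega> A) ` {\<alpha>. L2_set \<alpha> {1..n} = 1})"
proof (rule bdd_aboveI2)
  fix \<alpha> :: "nat \<Rightarrow> real" assume \<alpha>: "\<alpha> \<in> {\<alpha>. L2_set \<alpha> {1..n} = 1}"
  obtain w where w: "w \<in> A" using assms by blast
  have "weighted_dist n \<alpha> \<omega> A \<le> (\<Sum>i=1..n. \<bar>\<alpha> i\<bar> * of_bool (\<omega> i \<noteq> w i))"
    by (rule weighted_dist_le[OF w])
  also have "\<dots> \<le> (\<Sum>i=1..n. 1)"
  proof (rule sum_mono)
    fix i assume "i \<in> {1..n}"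
    then have "\<bar>\<alpha> i\<bar> \<le> 1"
      using member_le_L2_set[of "{1..n}" i "\<lambda>i. \<bar>\<alpha> i\<bar>"] \<alpha> by (simp add: L2_set_def)
    then show "\<bar>\<alpha> i\<bar> * of_bool (\<omega> i \<noteq> w i) \<le> 1" by simp
  qed
  finally show "weighted_dist n \<alpha> \<omega> A \<le> (\<Sum>i=1..n. 1)" .
qed

text \<open>Homogeneity in \<alpha> extends the defining bound from unit vectors to truncated ones.
  The zero vector cannot be normalised and is treated apart.\<close>

lemma weighted_dist_le_convex_dist:
  assumes "A \<noteq> {}" "n > 0"
  shows "weighted_dist n \<alpha> \<omega> A \<le> L2_set \<alpha> {1..n} * convex_dist n \<omega> A"
proof (cases "L2_set \<alpha> {1..n} = 0")
  case True
  then have "\<alpha> i = 0" if "i \<in> {1..n}" for i using that by (simp add: L2_set_eq_0_iff)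
  then show ?thesis using weighted_dist_zero[of _ A n \<alpha> \<omega>] assms True by auto
next
  case False
  define c where "c = L2_set \<alpha> {1..n}"
  have c: "c > 0" using False L2_set_nonneg[of \<alpha> "{1..n}"] unfolding c_def by linarith
  define \<beta> where "\<beta> = (\<lambda>i. \<alpha> i * (1 / c))"
  have "L2_set \<beta> {1..n} = c * (1 / c)"
    unfolding \<beta>_def c_def using c by (intro L2_set_left_distrib[symmetric]) (simp add: c_def)
  then have \<beta>: "L2_set \<beta> {1..n} = 1" using c by simp
  have "weighted_dist n \<alpha> \<omega> A / c \<le> weighted_dist n \<beta> \<omega> A"
  proof (rule le_weighted_dist[OF assms(1)])
    fix w assume "w \<in> A"
    then have "weighted_dist n \<alpha> \<omega> A / c \<le> (\<Sum>i=1..n. \<bar>\<alpha> i\<bar> * of_bool (\<omega> i \<noteq> w i)) / c"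
      using c by (intro divide_right_mono weighted_dist_le) auto
    also have "\<dots> = (\<Sum>i=1..n. \<bar>\<beta> i\<bar> * of_bool (\<omega> i \<noteq> w i))"
      unfolding sum_divide_distrib using c by (intro sum.cong) (auto simp: \<beta>_def abs_mult)
    finally show "weighted_dist n \<alpha> \<omega> A / c \<le> (\<Sum>i=1..n. \<bar>\<beta> i\<bar> * of_bool (\<omega> i \<noteq> w i))" .
  qed
  also have "\<dots> \<le> convex_dist n \<omega> A"
    using assms(2) \<beta> cSUP_upper[OF _ bdd_above_weighted_dist[OF assms(1)], of \<beta> n \<omega>]
    by (simp add: convex_dist_def)
  finally have "weighted_dist n \<alpha> \<omega> A \<le> c * convex_dist n \<omega> A" using c by (simp add: field_simps)
  then show ?thesis by (simp only: c_def)
qed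

lemma unit_vector_exists:
  assumes "n > 0" shows "{\<alpha> :: nat \<Rightarrow> real. L2_set \<alpha> {1..n} = 1} \<noteq> {}"
proof -
  have "L2_set (\<lambda>i. of_bool (i = 1)) {1..n} = (1::real)"
    using assms by (simp add: L2_set_def of_bool_def if_distrib[of "\<lambda>x. x\<^sup>2"] cong: if_cong)
  then show ?thesis by blast
qed

lemma convex_dist_nonneg:
  assumes "A \<noteq> {}" shows "convex_dist n \<omega> A \<ge> 0"
proof (cases "n = 0")
  case False
  then obtain \<alpha> :: "nat \<Rightarrow> real" where "L2_set \<alpha> {1..n} = 1" using unit_vector_exists[of n] by auto
  then show ?thesis
    using weighted_dist_le_convex_dist[OF assms, of n \<alpha> \<omega>] weighted_dist_nonneg[OF assms, of n \<alpha> \<omega>] False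
    by simp
qed (simp add: convex_dist_def)

lemma convex_dist_eq_0: 
  assumes "\<omega> \<in> A" shows "convex_dist n \<omega> A = 0"
proof (cases "n = 0")
  case False
  have "convex_dist n \<omega> A \<le> 0"
    using False weighted_dist_le[OF assms, of n _ \<omega>] unit_vector_exists[of n]
    by (auto simp: convex_dist_def intro!: cSUP_least)
  then show ?thesis using convex_dist_nonneg[of A n \<omega>] assms by auto
qed (simp add: convex_dist_def)

text \<open>Avoids showing that the supremum is attained.\<close>
lemma convex_dist_near_optimal:
  assumes "A \<noteq> {}" "n > 0" "\<epsilon> > 0"
  obtains \<alpha> where "L2_set \<alpha> {1..n} = 1" "convex_dist n \<omega> A < weighted_dist n \<alpha> \<omega> A + \<epsilon>"
proof -
  have "\<exists>\<alpha>\<in>{\<alpha>. L2_set \<alpha> {1..n} = 1}. convex_dist n \<omega> A - \<epsilon> < weighted_dist n \<alpha> \<omega> A"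
    using assms less_cSUP_iff[OF unit_vector_exists bdd_above_weighted_dist, of n A "convex_dist n \<omega> A - \<epsilon>" \<omega>]
    by (auto simp: convex_dist_def)
  then show thesis using that by force
qed

text \<open>Deleting \<open>a\<close> and \<open>b\<close> leaves a vector of norm \<open>l\<close>,
  giving the bound |\<alpha> a| + |\<alpha> b| + l d. Using \<open>l <= 1\<close> yields the first
  claim, suited to gradients. Cauchy-Schwarz against the vector (1, 1, d) yields the second, which
  no longer depends on \<alpha>.\<close>

lemma convex_dist_modify:
  fixes \<omega> \<omega>' :: "nat \<Rightarrow> nat"
  assumes "A \<noteq> {}" "a \<in> {1..n}" "b \<in> {1..n}" "a \<noteq> b"
    and eq: "\<And>i. i \<in> {1..n} \<Longrightarrow> i \<noteq> a \<Longrightarrow> i \<noteq> b \<Longrightarrow> \<omega> i = \<omega>' i"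
    and \<alpha>: "L2_set \<alpha> {1..n} = 1"
  shows "weighted_dist n \<alpha> \<omega> A \<le> \<bar>\<alpha> a\<bar> + \<bar>\<alpha> b\<bar> + convex_dist n \<omega>' A" (is ?A)
    and "weighted_dist n \<alpha> \<omega> A \<le> sqrt (2 + (convex_dist n \<omega>' A)\<^sup>2)" (is ?B)
proof -
  define d where "d = convex_dist n \<omega>' A"
  define l where "l = L2_set (\<alpha>(a := 0, b := 0)) {1..n}"
  have d: "d \<ge> 0" unfolding d_def by (rule convex_dist_nonneg[OF assms(1)])
  have "(\<Sum>i=1..n. (\<alpha> i)\<^sup>2) = 1" using \<alpha> by (simp add: L2_set_def)
  moreover have "(\<Sum>i=1..n. (\<alpha> i)\<^sup>2) = (\<Sum>i=1..n. (if i = a then (\<alpha> i)\<^sup>2 else 0)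
      + (if i = b then (\<alpha> i)\<^sup>2 else 0) + ((\<alpha>(a := 0, b := 0)) i)\<^sup>2)"
    using assms(4) by (intro sum.cong) auto
  moreover have "\<dots> = (\<alpha> a)\<^sup>2 + (\<alpha> b)\<^sup>2 + (\<Sum>i=1..n. ((\<alpha>(a := 0, b := 0)) i)\<^sup>2)"
    using assms(2,3) by (simp add: sum.distrib del: fun_upd_apply)
  moreover have "(\<Sum>i=1..n. ((\<alpha>(a := 0, b := 0)) i)\<^sup>2) = l\<^sup>2"
    by (simp add: l_def L2_set_def sum_nonneg)
  ultimately have sq: "(\<alpha> a)\<^sup>2 + (\<alpha> b)\<^sup>2 + l\<^sup>2 = 1" by simp
  have l: "l \<ge> 0" by (simp add: l_def)
  have "l\<^sup>2 \<le> 1\<^sup>2" using sq by (smt (verit) zero_le_power2 power_one)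
  then have l1: "l \<le> 1" using power2_le_imp_le[of l 1] by simp
  have le: "weighted_dist n \<alpha> \<omega> A \<le> \<bar>\<alpha> a\<bar> + \<bar>\<alpha> b\<bar> + l * d"
    using weighted_dist_modify[of A a n b \<omega> \<omega>' \<alpha>, OF assms(1-4) eq]
      weighted_dist_le_convex_dist[OF assms(1), of n "\<alpha>(a := 0, b := 0)" \<omega>'] assms(2)
    by (auto simp: l_def d_def)
  moreover have "l * d \<le> d" using l1 d by (simp add: mult_left_le_one_le l)
  ultimately show ?A by (simp add: d_def)
  have "(\<bar>\<alpha> a\<bar> + \<bar>\<alpha> b\<bar> + l * d)\<^sup>2 \<le> (\<bar>\<alpha> a\<bar>\<^sup>2 + \<bar>\<alpha> b\<bar>\<^sup>2 + l\<^sup>2) * (1\<^sup>2 + 1\<^sup>2 + d\<^sup>2)"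
  proof -
    \<comment> \<open>Lagrange's identity: the Cauchy-Schwarz defect is a sum of squares.\<close>
    have "(\<bar>\<alpha> a\<bar>\<^sup>2 + \<bar>\<alpha> b\<bar>\<^sup>2 + l\<^sup>2) * (1\<^sup>2 + 1\<^sup>2 + d\<^sup>2) - (\<bar>\<alpha> a\<bar> + \<bar>\<alpha> b\<bar> + l * d)\<^sup>2
      = (\<bar>\<alpha> a\<bar> - \<bar>\<alpha> b\<bar>)\<^sup>2 + (\<bar>\<alpha> a\<bar> * d - l)\<^sup>2 + (\<bar>\<alpha> b\<bar> * d - l)\<^sup>2"
      by (simp only: power2_eq_square) (simp only: algebra_simps)
    moreover have "\<dots> \<ge> 0" by simp
    ultimately show ?thesis by linarith
  qed
  then have "(\<bar>\<alpha> a\<bar> + \<bar>\<alpha> b\<bar> + l * d)\<^sup>2 \<le> 2 + d\<^sup>2" using sq by simp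
  then have "\<bar>\<alpha> a\<bar> + \<bar>\<alpha> b\<bar> + l * d \<le> sqrt (2 + d\<^sup>2)" by (rule real_le_rsqrt)
  then show ?B using le by (simp add: d_def)
qed

text \<open>The second bound above is uniform in \<alpha> and so passes to the supremum. It limits
  the effect of one swap on the squared distance independently of \<open>n\<close>.\<close>

lemma convex_dist_sq_modify:
  assumes "A \<noteq> {}" "a \<in> {1..n}" "b \<in> {1..n}" "a \<noteq> b"
    and eq: "\<And>i. i \<in> {1..n} \<Longrightarrow> i \<noteq> a \<Longrightarrow> i \<noteq> b \<Longrightarrow> \<omega> i = \<omega>' i"
  shows "(convex_dist n \<omega> A)\<^sup>2 \<le> 2 + (convex_dist n \<omega>' A)\<^sup>2"
proof -
  have "convex_dist n \<omega> A \<le> sqrt (2 + (convex_dist n \<omega>' A)\<^sup>2)"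
    using convex_dist_modify(2)[OF assms] unit_vector_exists[of n] assms(2)
    by (auto simp: convex_dist_def[of n \<omega>] intro!: cSUP_least)
  then have "(convex_dist n \<omega> A)\<^sup>2 \<le> (sqrt (2 + (convex_dist n \<omega>' A)\<^sup>2))\<^sup>2"
    by (intro power_mono convex_dist_nonneg assms(1))
  then show ?thesis by simp
qed

section \<open>Correspondence between the slice and sets of size r\<close>

text \<open>The restriction supplies \<open>undefined\<close> outside \<open>{1..n}\<close>, as
  membership in \<open>cube n\<close> demands.\<close>

definition indicator_vec :: "nat \<Rightarrow> nat set \<Rightarrow> nat \<Rightarrow> nat" where
  "indicator_vec n S = (\<lambda>i\<in>{1..n}. of_bool (i \<in> S))"

lemma bij_betw_indicator_vec:
  "bij_betw (indicator_vec n) (ksubsets {1..n} r) (slice n r)"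
proof (rule bij_betw_byWitness[where f' = "\<lambda>\<eta>. {i \<in> {1..n}. \<eta> i = 1}"])
  show "\<forall>S\<in>ksubsets {1..n} r. {i \<in> {1..n}. indicator_vec n S i = 1} = S"
    by (auto simp: ksubsets_def indicator_vec_def)
  have ev: "\<eta> i = of_bool (\<eta> i = 1)" if "\<eta> \<in> cube n" "i \<in> {1..n}" for \<eta> i
  proof -
    have "\<eta> i \<in> {0, 1}" using that by (auto simp: cube_def)
    then show ?thesis by auto
  qed
  show "\<forall>\<eta>\<in>slice n r. indicator_vec n {i \<in> {1..n}. \<eta> i = 1} = \<eta>"
  proof
    fix \<eta> assume "\<eta> \<in> slice n r"
    then have \<eta>: "\<eta> \<in> cube n" by (simp add: slice_def)
    show "indicator_vec n {i \<in> {1..n}. \<eta> i = 1} = \<eta>"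
    proof
      fix i show "indicator_vec n {i \<in> {1..n}. \<eta> i = 1} i = \<eta> i"
        using ev[OF \<eta>, of i] \<eta> by (cases "i \<in> {1..n}") (auto simp: indicator_vec_def cube_def PiE_def extensional_def)
    qed
  qed
  show "indicator_vec n ` ksubsets {1..n} r \<subseteq> slice n r"
  proof
    fix \<eta> assume "\<eta> \<in> indicator_vec n ` ksubsets {1..n} r"
    then obtain S where S: "\<eta> = indicator_vec n S" "S \<subseteq> {1..n}" "card S = r" by (auto simp: ksubsets_def)
    have "(\<Sum>i=1..n. \<eta> i) = (\<Sum>i=1..n. of_bool (i \<in> S))"
      by (intro sum.cong) (auto simp: S(1) indicator_vec_def)
    also have "\<dots> = card ({1..n} \<inter> S)" by (subst sum_of_bool_eq) auto
    also have "{1..n} \<inter> S = S" using S by auto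
    finally show "\<eta> \<in> slice n r" using S by (auto simp: slice_def cube_def indicator_vec_def)
  qed
  show "(\<lambda>\<eta>. {i \<in> {1..n}. \<eta> i = 1}) ` slice n r \<subseteq> ksubsets {1..n} r"
  proof (intro image_subsetI)
    fix \<eta> assume \<eta>: "\<eta> \<in> slice n r"
    then have "r = (\<Sum>i=1..n. \<eta> i)" by (simp add: slice_def)
    also have "\<dots> = (\<Sum>i=1..n. of_bool (\<eta> i = 1))"
      using \<eta> ev by (intro sum.cong) (auto simp: slice_def)
    also have "\<dots> = card {i \<in> {1..n}. \<eta> i = 1}" by (subst sum_of_bool_eq) (auto intro: arg_cong[where f = card])
    finally show "{i \<in> {1..n}. \<eta> i = 1} \<in> ksubsets {1..n} r" by (auto simp: ksubsets_def)
  qed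
qed

lemma indicator_vec_swap:
  "i \<noteq> a \<Longrightarrow> i \<noteq> b \<Longrightarrow> indicator_vec n S i = indicator_vec n (swap a b S) i"
  by (auto simp: indicator_vec_def swap_def restrict_def)

section \<open>Self-bounding squared distance and the entropy estimate\<close>

text \<open>One nearly optimal \<alpha> at \<open>S\<close> serves all swaps at once. It controls
  only decreases of the distance, hence the positive part. The factor 36 is 4 from squaring
  \<open>2 * d S\<close>, 3 from the square of a three-term sum, and 3 from three sums over pairs,
  each at most \<open>n\<close>.\<close>

lemma convex_dist_sq_gradient:
  assumes A: "A \<noteq> {}" and n: "n > 0" and S: "S \<in> ksubsets {1..n} r"
  defines "g \<equiv> \<lambda>S. (convex_dist n (indicator_vec n S) A)\<^sup>2"
  shows "(\<Sum>(a,b)\<in>S \<times> ({1..n} - S). (max 0 (g S - g (swap a b S)))\<^sup>2) \<le> 36 * n * g S"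
proof -
  define d where "d S = convex_dist n (indicator_vec n S) A" for S
  have d: "d S \<ge> 0" for S unfolding d_def by (rule convex_dist_nonneg[OF A])
  \<comment> \<open>With slack 1/n, the squared errors over all \<open>n * n\<close> pairs total 1,
    which is at most \<open>n\<close>.\<close>
  obtain \<alpha> where \<alpha>: "L2_set \<alpha> {1..n} = 1"
      "d S < weighted_dist n \<alpha> (indicator_vec n S) A + 1 / n"
    using convex_dist_near_optimal[OF A n, of "1/n" "indicator_vec n S"] n unfolding d_def by auto
  have sub: "S \<subseteq> {1..n}" using S by (simp add: ksubsets_def)
  have one: "(max 0 (g S - g (swap a b S)))\<^sup>2 \<le> 12 * g S * ((\<alpha> a)\<^sup>2 + (\<alpha> b)\<^sup>2 + (1/n)\<^sup>2)"
    if ab: "a \<in> S" "b \<in> {1..n} - S" for a b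
  proof -
    have "weighted_dist n \<alpha> (indicator_vec n S) A \<le> \<bar>\<alpha> a\<bar> + \<bar>\<alpha> b\<bar> + d (swap a b S)"
      unfolding d_def using ab sub
      by (intro convex_dist_modify(1) A \<alpha>(1) indicator_vec_swap) auto
    then have dd: "d S - d (swap a b S) \<le> \<bar>\<alpha> a\<bar> + \<bar>\<alpha> b\<bar> + 1/n" using \<alpha>(2) by linarith
    have "max 0 (g S - g (swap a b S)) \<le> 2 * d S * (\<bar>\<alpha> a\<bar> + \<bar>\<alpha> b\<bar> + 1/n)"
    proof (cases "d S \<le> d (swap a b S)")
      case True
      then have "g S \<le> g (swap a b S)" unfolding g_def d_def[symmetric] using d by (intro power_mono) auto
      then show ?thesis using d by simp
    next
      case False
      have "g S - g (swap a b S) = (d S + d (swap a b S)) * (d S - d (swap a b S))"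
        unfolding g_def d_def[symmetric] by (simp add: power2_eq_square algebra_simps)
      also have "\<dots> \<le> (2 * d S) * (\<bar>\<alpha> a\<bar> + \<bar>\<alpha> b\<bar> + 1/n)"
        using False dd d[of S] d[of "swap a b S"] by (intro mult_mono) auto
      finally show ?thesis using d by simp
    qed
    then have "(max 0 (g S - g (swap a b S)))\<^sup>2 \<le> (2 * d S * (\<bar>\<alpha> a\<bar> + \<bar>\<alpha> b\<bar> + 1/n))\<^sup>2"
      by (intro power_mono) auto
    also have "\<dots> = 4 * g S * (\<bar>\<alpha> a\<bar> + \<bar>\<alpha> b\<bar> + 1/n)\<^sup>2"
      by (simp add: g_def d_def power_mult_distrib)
    also have "\<dots> \<le> 4 * g S * (3 * ((\<alpha> a)\<^sup>2 + (\<alpha> b)\<^sup>2 + (1/n)\<^sup>2))"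
    proof (rule mult_left_mono)
      have "(x + y + z)\<^sup>2 \<le> 3 * (x\<^sup>2 + y\<^sup>2 + z\<^sup>2)" for x y z :: real
      proof -
        have "3 * (x\<^sup>2 + y\<^sup>2 + z\<^sup>2) - (x + y + z)\<^sup>2 = (x-y)\<^sup>2 + (x-z)\<^sup>2 + (y-z)\<^sup>2"
          by (simp add: power2_eq_square algebra_simps)
        moreover have "\<dots> \<ge> 0" by simp
        ultimately show ?thesis by linarith
      qed
      from this[of "\<bar>\<alpha> a\<bar>" "\<bar>\<alpha> b\<bar>" "1/n"]
      show "(\<bar>\<alpha> a\<bar> + \<bar>\<alpha> b\<bar> + 1/n)\<^sup>2 \<le> 3 * ((\<alpha> a)\<^sup>2 + (\<alpha> b)\<^sup>2 + (1/n)\<^sup>2)" by simp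
    qed (simp add: g_def)
    finally show ?thesis by (simp add: algebra_simps)
  qed
  have "(\<Sum>(a,b)\<in>S \<times> ({1..n} - S). (max 0 (g S - g (swap a b S)))\<^sup>2)
     \<le> (\<Sum>(a,b)\<in>S \<times> ({1..n} - S). 12 * g S * ((\<alpha> a)\<^sup>2 + (\<alpha> b)\<^sup>2 + (1/n)\<^sup>2))"
    using one by (intro sum_mono) auto
  \<comment> \<open>Over all pairs the sum of squares factorises, and \<alpha> enters only through
    its norm.\<close>
  also have "\<dots> \<le> (\<Sum>(a,b)\<in>{1..n} \<times> {1..n}. 12 * g S * ((\<alpha> a)\<^sup>2 + (\<alpha> b)\<^sup>2 + (1/n)\<^sup>2))"
    using sub by (intro sum_mono2) (auto simp: g_def)
  also have "\<dots> = 12 * g S * (\<Sum>a=1..n. \<Sum>b=1..n. (\<alpha> a)\<^sup>2 + (\<alpha> b)\<^sup>2 + (1/n)\<^sup>2)"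
    by (simp add: sum.cartesian_product sum_distrib_left case_prod_unfold)
  also have "(\<Sum>a=1..n. \<Sum>b=1..n. (\<alpha> a)\<^sup>2 + (\<alpha> b)\<^sup>2 + (1/n)\<^sup>2)
      = n * (\<Sum>a=1..n. (\<alpha> a)\<^sup>2) + n * (\<Sum>a=1..n. (\<alpha> a)\<^sup>2) + real n * n * (1/n)\<^sup>2"
    by (simp add: sum.distrib sum_distrib_left)
  also have "(\<Sum>a=1..n. (\<alpha> a)\<^sup>2) = 1" using \<alpha>(1) by (simp add: L2_set_def)
  also have "12 * g S * (real n * 1 + real n * 1 + real n * n * (1/n)\<^sup>2) \<le> 36 * n * g S"
  proof -
    have "real n * n * (1/n)\<^sup>2 \<le> n" using n by (simp add: power2_eq_square)
    then have "12 * g S * (real n * 1 + real n * 1 + real n * n * (1/n)\<^sup>2) \<le> 12 * g S * (3 * n)"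
      by (intro mult_left_mono) (auto simp: g_def)
    then show ?thesis by (simp add: mult_ac)
  qed
  finally show ?thesis by simp
qed

text \<open>Convexity of exp puts the larger exponential in front of the squared difference. For
  negative \<open>t\<close> this belongs to the point with the smaller value, while the gradient
  bound needs the larger value; moving the weight between the two points costs at most
  \<open>exp (2 * \<bar>t\<bar>)\<close>.\<close>

lemma dform_exp_le:
  fixes t x y :: real
  assumes "\<bar>x - y\<bar> \<le> 2"
  shows "dform (exp (t * x)) (exp (t * y)) \<le> t\<^sup>2 * exp (2 * \<bar>t\<bar>)
    * (exp (t * x) * (max 0 (x - y))\<^sup>2 + exp (t * y) * (max 0 (y - x))\<^sup>2)"
proof -
  define u v where "u = t * x" and "v = t * y"
  have e: "exp u - exp v \<le> exp u * (u - v)" for u v :: real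
  proof -
    have "exp u * (1 + (v - u)) \<le> exp u * exp (v - u)" by (intro mult_left_mono exp_ge_add_one_self) auto
    then show ?thesis by (simp add: algebra_simps flip: exp_add)
  qed
  have uv: "dform (exp u) (exp v) \<le> exp (max u v) * (u - v)\<^sup>2"
  proof (cases "v \<le> u")
    case True
    then have "(exp u - exp v) * (u - v) \<le> exp u * (u - v) * (u - v)"
      by (intro mult_right_mono e) auto
    then show ?thesis using True by (simp add: dform_def power2_eq_square mult_ac max_def)
  next
    case False
    then have "(exp v - exp u) * (v - u) \<le> exp v * (v - u) * (v - u)"
      by (intro mult_right_mono e) auto
    then show ?thesis using False by (simp add: dform_def power2_eq_square algebra_simps max_def)
  qed
  have "\<bar>u - v\<bar> = \<bar>t\<bar> * \<bar>x - y\<bar>" by (simp add: u_def v_def abs_mult flip: right_diff_distrib)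
  also have "\<dots> \<le> \<bar>t\<bar> * 2" using assms by (intro mult_left_mono) auto
  finally have close: "\<bar>u - v\<bar> \<le> 2 * \<bar>t\<bar>" by simp
  have m: "exp (max u v) * (u - v)\<^sup>2 \<le> exp w * exp (2 * \<bar>t\<bar>) * (u - v)\<^sup>2" if "w \<in> {u, v}" for w
    using close that by (intro mult_right_mono) (auto simp flip: exp_add)
  have sq: "(u - v)\<^sup>2 = t\<^sup>2 * (x - y)\<^sup>2" by (simp add: u_def v_def power_mult_distrib flip: right_diff_distrib)
  show ?thesis
  proof (cases "y \<le> x")
    case True
    then show ?thesis using uv m[of u] by (simp add: sq mult_ac u_def[symmetric] v_def[symmetric])
  next
    case False
    then show ?thesis using uv m[of v] by (simp add: sq mult_ac u_def[symmetric] v_def[symmetric] power2_commute[of y x])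
  qed
qed

text \<open>The factor \<open>n\<close> in the log-Sobolev inequality cancels the one in the
  gradient bound. Both directions of each swap turn 36 into 72, and the exponential factor for small
  \<open>t\<close> raises this to at most 80.\<close>

lemma ent_exp_convex_dist_sq_le:
  assumes A: "A \<noteq> {}" and n: "n > 0" and t: "\<bar>t\<bar> \<le> 1/40"
  defines "g \<equiv> \<lambda>S. (convex_dist n (indicator_vec n S) A)\<^sup>2"
  shows "ent (ksubsets {1..n} r) (\<lambda>S. exp (t * g S))
     \<le> 80 * t\<^sup>2 * (\<Sum>S\<in>ksubsets {1..n} r. g S * exp (t * g S))"
proof -
  define K where "K = t\<^sup>2 * exp (2 * \<bar>t\<bar>)"
  define h where "h S T = K * exp (t * g S) * (max 0 (g S - g T))\<^sup>2" for S T
  have K0: "K \<ge> 0" by (simp add: K_def)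
  have "n * ent (ksubsets {1..n} r) (\<lambda>S. exp (t * g S))
      \<le> (\<Sum>(S,a,b)\<in>swaps {1..n} r. dform (exp (t * g S)) (exp (t * g (swap a b S))))"
    using modified_log_sobolev_slice[of "{1..n}" r "\<lambda>S. exp (t * g S)"] by simp
  also have "\<dots> \<le> (\<Sum>(S,a,b)\<in>swaps {1..n} r. h S (swap a b S) + h (swap a b S) S)"
  proof (rule sum_mono)
    fix q assume q: "q \<in> swaps {1..n} r"
    obtain S a b where S: "q = (S, a, b)" by (cases q)
    have ab: "a \<in> {1..n}" "b \<in> {1..n}" "a \<noteq> b" using q by (auto simp: S mem_swaps ksubsets_def)
    have "g S \<le> 2 + g (swap a b S)"
      unfolding g_def by (rule convex_dist_sq_modify[OF A ab]) (rule indicator_vec_swap)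
    moreover have "g (swap a b S) \<le> 2 + g S"
      unfolding g_def by (rule convex_dist_sq_modify[OF A ab]) (rule indicator_vec_swap[symmetric])
    ultimately have "\<bar>g S - g (swap a b S)\<bar> \<le> 2" by linarith
    then show "(case q of (S,a,b) \<Rightarrow> dform (exp (t * g S)) (exp (t * g (swap a b S))))
      \<le> (case q of (S,a,b) \<Rightarrow> h S (swap a b S) + h (swap a b S) S)"
      using dform_exp_le[of "g S" "g (swap a b S)" t] by (simp add: S h_def K_def algebra_simps)
  qed
  \<comment> \<open>Reversing the swaps identifies the sum of upward differences with that of
    downward ones, so only decrements from \<open>S\<close> remain.\<close>
  also have "\<dots> = 2 * (\<Sum>(S,a,b)\<in>swaps {1..n} r. h S (swap a b S))"
    using sum_swaps_flip[of "{1..n}" h r] by (simp add: sum.distrib case_prod_unfold)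
  also have "(\<Sum>(S,a,b)\<in>swaps {1..n} r. h S (swap a b S))
      = (\<Sum>S\<in>ksubsets {1..n} r. \<Sum>(a,b)\<in>S \<times> ({1..n} - S). h S (swap a b S))"
    unfolding swaps_def by (subst sum.Sigma) (auto simp: ksubsets_def finite_subset)
  also have "\<dots> = (\<Sum>S\<in>ksubsets {1..n} r. K * exp (t * g S) *
      (\<Sum>(a,b)\<in>S \<times> ({1..n} - S). (max 0 (g S - g (swap a b S)))\<^sup>2))"
    by (simp add: h_def sum_distrib_left case_prod_unfold)
  also have "\<dots> \<le> (\<Sum>S\<in>ksubsets {1..n} r. K * exp (t * g S) * (36 * n * g S))"
    using convex_dist_sq_gradient[OF A n] K0 unfolding g_def
    by (intro sum_mono mult_left_mono) auto
  also have "2 * \<dots> = n * (72 * K * (\<Sum>S\<in>ksubsets {1..n} r. g S * exp (t * g S)))"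
    by (simp add: sum_distrib_left mult_ac)
  finally have "ent (ksubsets {1..n} r) (\<lambda>S. exp (t * g S))
      \<le> 72 * K * (\<Sum>S\<in>ksubsets {1..n} r. g S * exp (t * g S))"
    using n by simp
  also have "\<dots> \<le> 80 * t\<^sup>2 * (\<Sum>S\<in>ksubsets {1..n} r. g S * exp (t * g S))"
  proof (rule mult_right_mono)
    have "exp (2 * \<bar>t\<bar>) \<le> exp (1/20)" using t by simp
    also have "\<dots> \<le> 1 + 1/20 + (1/20)\<^sup>2" by (rule exp_bound) auto
    finally have "exp (2 * \<bar>t\<bar>) \<le> 80/72" by (simp add: power2_eq_square)
    then have "t\<^sup>2 * exp (2 * \<bar>t\<bar>) \<le> t\<^sup>2 * (80/72)" by (intro mult_left_mono) auto
    then show "72 * K \<le> 80 * t\<^sup>2" by (simp add: K_def)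
    show "0 \<le> (\<Sum>S\<in>ksubsets {1..n} r. g S * exp (t * g S))" by (auto intro!: sum_nonneg simp: g_def)
  qed
  finally show ?thesis .
qed

section \<open>Passage from the log-Laplace transform to the exponential inequality\<close>

theorem proposition1p11:
  fixes n r :: nat and A :: "(nat \<Rightarrow> nat) set"
  assumes "r \<le> n"
    and "A \<subseteq> slice n r"
    and "A \<noteq> {}"
  shows "measure (slice_measure n r) A *
      (\<integral>\<eta>. exp ((convex_dist n \<eta> A)\<^sup>2 / 544) \<partial>slice_measure n r) \<le> 1"
proof -
  define X where "X = ksubsets {1..n} r"
  define g where "g S = (convex_dist n (indicator_vec n S) A)\<^sup>2" for S
  define F where "F t = (\<Sum>S\<in>X. exp (t * g S))" for t
  define N where "N = real (card X)"
  note bij = bij_betw_indicator_vec[of n r, folded X_def]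
  have finX: "finite X" by (simp add: X_def)
  have finS: "finite (slice n r)" using bij finX bij_betw_finite by blast
  have X: "X \<noteq> {}" using bij assms(2,3) by (auto simp: bij_betw_def)
  have N: "N > 0" using finX X by (simp add: N_def card_gt_0_iff)
  have cS: "real (card (slice n r)) = N" using bij_betw_same_card[OF bij] by (simp add: N_def)
  have g0: "g S \<ge> 0" for S by (simp add: g_def)
  have F: "F t > 0" for t unfolding F_def using finX X by (intro sum_pos) auto
  have meas: "measure (slice_measure n r) A = card A / N"
    using measure_uniform_count_measure[OF finS assms(2)] by (simp add: slice_measure_def cS)
  have "(\<integral>\<eta>. exp ((convex_dist n \<eta> A)\<^sup>2 / 544) \<partial>slice_measure n r)
      = (\<Sum>\<eta>\<in>slice n r. exp ((convex_dist n \<eta> A)\<^sup>2 / 544)) / N"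
    using integral_uniform_count_measure[OF finS] by (simp add: slice_measure_def cS)
  also have "(\<Sum>\<eta>\<in>slice n r. exp ((convex_dist n \<eta> A)\<^sup>2 / 544)) = F (1/544)"
    unfolding F_def g_def by (subst sum.reindex_bij_betw[OF bij, symmetric]) simp
  finally have int: "(\<integral>\<eta>. exp ((convex_dist n \<eta> A)\<^sup>2 / 544) \<partial>slice_measure n r) = F (1/544) / N" .
  \<comment> \<open>The distance vanishes on \<open>A\<close>, so each of its points contributes 1
    to the negative exponential sum.\<close>
  have A: "card A \<le> F (-1/40)"
  proof -
    have "real (card A) = (\<Sum>\<eta>\<in>A. exp (- (1/40) * (convex_dist n \<eta> A)\<^sup>2))" by (simp add: convex_dist_eq_0)
    also have "\<dots> \<le> (\<Sum>\<eta>\<in>slice n r. exp (- (1/40) * (convex_dist n \<eta> A)\<^sup>2))"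
      using assms(2) finS by (intro sum_mono2) auto
    also have "\<dots> = F (-1/40)"
      unfolding F_def g_def by (subst sum.reindex_bij_betw[OF bij, symmetric]) simp
    finally show ?thesis .
  qed
  have "F (-1/40) / N * (F (1/544) / N) \<le> 1"
  proof (cases "n = 0")
    \<comment> \<open>In dimension zero \<open>convex_dist\<close> is 0 by definition.\<close>
    case True
    then have "g S = 0" for S by (simp add: g_def convex_dist_def)
    then have "F t = N" for t by (simp add: F_def N_def)
    then show ?thesis using N by simp
  next
    case False
    define \<psi> where "\<psi> t = ln (F t / N)" for t
    have "\<psi> (1/544) / (1/544) - 80 * \<psi> (1/544) \<le> \<psi> (-(1/40)) / (-(1/40)) - 80 * \<psi> (-(1/40))"
      unfolding \<psi>_def F_def N_def
      by (rule herbst[OF finX X])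
         (use ent_exp_convex_dist_sq_le[OF assms(3), of n _ r] False in \<open>auto simp: X_def g_def\<close>)
    \<comment> \<open>The coefficients are 544 - 80 = 464 and -40 - 80 = -120. As \<psi>(-1/40) is
      nonpositive and 120 <= 464, the sum of the two values of \<psi> is nonpositive.\<close>
    then have main: "464 * \<psi> (1/544) \<le> - 120 * \<psi> (-1/40)" by simp
    have "F (-1/40) \<le> (\<Sum>S\<in>X. 1)" unfolding F_def using g0 by (intro sum_mono) simp
    then have "F (-1/40) \<le> N" by (simp add: N_def)
    then have "\<psi> (-1/40) \<le> 0" unfolding \<psi>_def using F[of "-1/40"] N by simp
    then have "\<psi> (-1/40) + \<psi> (1/544) \<le> 0" using main by simp
    moreover have "\<psi> (-1/40) + \<psi> (1/544) = ln (F (-1/40) / N * (F (1/544) / N))"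
      unfolding \<psi>_def using F N by (intro ln_mult_pos[symmetric]) auto
    moreover have "F (-1/40) / N * (F (1/544) / N) > 0" using F N by simp
    ultimately show ?thesis using ln_le_zero_iff by metis
  qed
  moreover have "card A / N * (F (1/544) / N) \<le> F (-1/40) / N * (F (1/544) / N)"
    using A F[of "1/544"] N by (intro mult_right_mono divide_right_mono) auto
  ultimately show ?thesis unfolding meas int by linarith
qed

end
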